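(* If $k\ge 4$ is an even integer and $G$ is a connected graph of order $n$, size $m$ and maximum degree $\Delta(G)\le k$, then both of the following hold: (a) $\displaystyle \alpha'(G) \ge \frac{n}{k(k+1)} + \frac{m}{k+1} - \frac{1}{k}$; (b) $\displaystyle \alpha'(G) \ge \left(\frac{k+2}{k^2+k+2}\right) m - \left(\frac{k-2}{k^2+k+2}\right) n - \frac{k+2}{k^2+k+2}$.
   Context: Graphs are finite, simple and undirected, with at least one vertex. The order of a graph is its number of vertices and the size is its number of edges. The matching number $\alpha'(G)$ is the maximum number of edges in a matching of $G$. *)

theory Defs
  imports Complex_Main
begin

locale simple_graph =
  fixes V :: "'a set" and E :: "'a set set"
  assumes finite_verts: "finite V"
    and verts_nonempty: "V \<noteq> {}"
    and edges: "e \<in> E \<Longrightarrow> e \<subseteq> V \<and> card e = 2"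

definition adj :: "'a set set \<Rightarrow> ('a \<times> 'a) set" where
  "adj E = {(u, v). {u, v} \<in> E}"

definition graph_connected :: "'a set \<Rightarrow> 'a set set \<Rightarrow> bool" where
  "graph_connected V E \<longleftrightarrow> (\<forall>u\<in>V. \<forall>v\<in>V. (u, v) \<in> (adj E)\<^sup>*)"

definition degree :: "'a set set \<Rightarrow> 'a \<Rightarrow> nat" where
  "degree E v = card {e \<in> E. v \<in> e}"

definition max_degree :: "'a set \<Rightarrow> 'a set set \<Rightarrow> nat" where
  "max_degree V E = Max (degree E ` V)"

definition matching :: "'a set set \<Rightarrow> 'a set set \<Rightarrow> bool" where
  "matching E M \<longleftrightarrow> M \<subseteq> E \<and> pairwise disjnt M"

definition matching_number :: "'a set set \<Rightarrow> nat" where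
  "matching_number E = Max (card ` {M. matching E M})"

text \<open>The maxima above range over finite nonempty sets, and are hence attained.\<close>

context simple_graph
begin

lemma finite_edges: "finite E"
  using finite_verts edges by (auto intro: finite_subset[of E "Pow V"])

lemma max_degree_attained: "\<exists>v\<in>V. degree E v = max_degree V E"
proof -
  have "Max (degree E ` V) \<in> degree E ` V"
    using finite_verts verts_nonempty by (intro Max_in) auto
  then show ?thesis by (auto simp: max_degree_def)
qed

lemma degree_le_max_degree: "v \<in> V \<Longrightarrow> degree E v \<le> max_degree V E"
  using finite_verts by (simp add: max_degree_def)

lemma finite_matchings: "finite {M. matching E M}"
  using finite_edges by (auto simp: matching_def intro: finite_subset[of _ "Pow E"])

lemma matching_number_attained: "\<exists>M. matching E M \<and> card M = matching_number E"
proof -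
  have "{} \<in> {M. matching E M}" by (simp add: matching_def)
  then have "Max (card ` {M. matching E M}) \<in> card ` {M. matching E M}"
    using finite_matchings by (intro Max_in) auto
  then show ?thesis by (auto simp: matching_number_def)
qed

lemma card_matching_le: "matching E M \<Longrightarrow> card M \<le> matching_number E"
  using finite_matchings by (simp add: matching_number_def)

end

end

theory Submission
  imports Defs "HOL-Library.Disjoint_Sets"
begin

text \<open>By the Tutte--Berge formula there is a vertex set \<open>S\<close> and a partition of the remaining vertices
  into parts without edges between them such that the matching number is at least \<open>card S\<close> plus
  the sum of \<open>card p div 2\<close> over the parts \<open>p\<close>. At most \<open>k * card S\<close> edges meet \<open>S\<close>, and
  connectedness forces at least as many of them as a spanning tree of the graph with contracted parts
  has. The claim then reduces to an inequality for every single part, which is sharp for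
  \<open>K\<^bsub>k+1\<^esub>\<close>; that part occurs only if \<open>S\<close> is empty and \<open>G\<close> is \<open>K\<^bsub>k+1\<^esub>\<close> itself.\<close>

section \<open>Maximum matchings and the exchange step\<close>

definition maximum_matching :: "'a set set \<Rightarrow> 'a set set \<Rightarrow> bool" where
  "maximum_matching E M \<longleftrightarrow> matching E M \<and> (\<forall>N. matching E N \<longrightarrow> card N \<le> card M)"

text \<open>Differs from \<open>simple_graph\<close> in allowing an empty vertex set, because the
  induction for the Tutte-Berge formula deletes vertices one by one.\<close>

locale pregraph =
  fixes V :: "'a set" and E :: "'a set set"
  assumes finite_V: "finite V"
    and edge: "e \<in> E \<Longrightarrow> e \<subseteq> V \<and> card e = 2"
begin

lemma finite_E: "finite E"
  using finite_V edge by (auto intro: finite_subset[of E "Pow V"])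

lemma edge_finite: "e \<in> E \<Longrightarrow> finite e"
  using edge finite_V finite_subset by blast

lemma matching_finite: "matching E M \<Longrightarrow> finite M"
  using finite_E by (auto simp: matching_def intro: finite_subset)

lemma matching_disjoint:
  "matching E M \<Longrightarrow> e \<in> M \<Longrightarrow> f \<in> M \<Longrightarrow> x \<in> e \<Longrightarrow> x \<in> f \<Longrightarrow> e = f"
  by (auto simp: matching_def pairwise_def disjnt_def)

lemma edge_other_end:
  assumes "e \<in> E" "x \<in> e" obtains y where "e = {x, y}" "y \<noteq> x"
proof -
  have "card e = 2" using edge assms by blast
  then obtain a b where "e = {a, b}" "a \<noteq> b" by (auto simp: card_2_iff)
  then show thesis using assms that by (metis doubleton_eq_iff insertE singletonD)
qed

lemma card_Union_matching:
  assumes "matching E M" shows "finite (\<Union>M)" "card (\<Union>M) = 2 * card M"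
proof -
  have ME: "M \<subseteq> E" using assms by (simp add: matching_def)
  show "finite (\<Union>M)" using ME edge_finite matching_finite[OF assms] by blast
  have "card (\<Union>M) = sum card M"
    using assms ME edge_finite by (intro card_Union_disjoint) (auto simp: matching_def)
  also have "\<dots> = 2 * card M" using ME edge by (simp add: subset_iff)
  finally show "card (\<Union>M) = 2 * card M" .
qed

lemma maximum_matching_exists: "\<exists>M. maximum_matching E M"
proof -
  have "matching E {}" by (simp add: matching_def)
  moreover have "\<forall>N. matching E N \<longrightarrow> card N < Suc (card E)"
    using card_mono[OF finite_E] by (simp add: matching_def less_Suc_eq_le)
  ultimately show ?thesis unfolding maximum_matching_def by (rule ex_has_greatest_nat)
qed

lemma maximum_matching_covers_edge:
  assumes "maximum_matching E M" "{x, y} \<in> E" "x \<notin> \<Union>M"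
  shows "y \<in> \<Union>M"
proof (rule ccontr)
  assume y: "y \<notin> \<Union>M"
  have M: "matching E M" using assms by (simp add: maximum_matching_def)
  have "matching E (insert {x, y} M)"
    using M assms y unfolding matching_def pairwise_insert by (auto simp: disjnt_def)
  moreover have "card (insert {x, y} M) = Suc (card M)"
    using assms(3) matching_finite[OF M] by (intro card_insert_disjoint) auto
  ultimately show False using assms(1) unfolding maximum_matching_def by fastforce
qed

text \<open>Swapping the edge of \<open>M\<close> at \<open>x\<close> into \<open>N\<close> replaces the usual alternating-path argument.\<close>

lemma maximum_matching_exchange:
  assumes M: "maximum_matching E M" and N: "maximum_matching E N"
    and x: "x \<in> \<Union>M" "x \<notin> \<Union>N" and v: "v \<notin> \<Union>N" "v \<noteq> x"
  shows "\<exists>N'. maximum_matching E N' \<and> v \<notin> \<Union>N' \<and> card (M \<inter> N) < card (M \<inter> N')"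
proof -
  have mM: "matching E M" and mN: "matching E N"
    using M N by (auto simp: maximum_matching_def)
  obtain e where e: "e \<in> M" "x \<in> e" using x by blast
  have eE: "e \<in> E" using e mM by (auto simp: matching_def)
  obtain y where y: "e = {x, y}" "y \<noteq> x" using edge_other_end[OF eE e(2)] by blast
  have "y \<in> \<Union>N" using maximum_matching_covers_edge[OF N] x eE y by blast
  then obtain f where f: "f \<in> N" "y \<in> f" by blast
  \<comment> \<open>\<open>f\<close> is not \<open>e\<close>, since no edge of \<open>N\<close>
    contains \<open>x\<close>; both contain \<open>y\<close>, so \<open>f\<close> cannot lie in
    \<open>M\<close>. Trading \<open>f\<close> for \<open>e\<close> therefore loses nothing of the
    overlap with \<open>M\<close>, and it keeps \<open>v\<close> missed because \<open>v\<close> is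
    neither \<open>x\<close> nor the \<open>N\<close>-covered vertex \<open>y\<close>.\<close>
  have fM: "f \<notin> M" using matching_disjoint[OF mM e(1), of f y] f x y by auto
  have eN: "e \<notin> N" using e x by blast
  let ?N = "insert e (N - {f})"
  have only: "g = f" if "g \<in> N" "y \<in> g" for g using matching_disjoint[OF mN] f that by blast
  have mt: "matching E ?N"
    using mN eE x only y unfolding matching_def pairwise_insert
    by (auto simp: disjnt_def pairwise_def)
  have fin: "finite N" "finite M" using mN mM matching_finite by auto
  have "card ?N = card N" using fin f eN card_Suc_Diff1[of N f] by simp
  then have "maximum_matching E ?N" using mt N by (auto simp: maximum_matching_def)
  moreover have "v \<notin> \<Union>?N" using v f y by auto
  moreover have "M \<inter> ?N = insert e (M \<inter> N)" using e fM by auto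
  then have "card (M \<inter> ?N) = Suc (card (M \<inter> N))" using fin eN by simp
  ultimately show ?thesis by (metis lessI)
qed

section \<open>Gallai's lemma\<close>

text \<open>Suppose \<open>M\<close> misses both \<open>u\<close> and \<open>w\<close>; then it
  covers \<open>v\<close>. Among the maximum matchings that miss \<open>v\<close>, take
  \<open>N\<close> with the largest overlap with \<open>M\<close>. Counting covered vertices yields
  some \<open>x\<close> other than \<open>v\<close> that \<open>M\<close> covers and
  \<open>N\<close> misses, and the exchange at \<open>x\<close> enlarges the overlap.\<close>

lemma inseparable_trans:
  assumes sep_uv: "\<And>M. maximum_matching E M \<Longrightarrow> u \<in> \<Union>M \<or> v \<in> \<Union>M"
    and sep_vw: "\<And>M. maximum_matching E M \<Longrightarrow> v \<in> \<Union>M \<or> w \<in> \<Union>M"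
    and miss_v: "\<exists>M. maximum_matching E M \<and> v \<notin> \<Union>M"
    and M: "maximum_matching E M" and "u \<noteq> w"
  shows "u \<in> \<Union>M \<or> w \<in> \<Union>M"
proof (rule ccontr)
  assume nc: "\<not> ?thesis"
  then have vM: "v \<in> \<Union>M" using sep_uv[OF M] by blast
  have mM: "matching E M" using M by (auto simp: maximum_matching_def)
  let ?Q = "\<lambda>N. maximum_matching E N \<and> v \<notin> \<Union>N"
  have "\<forall>N. ?Q N \<longrightarrow> card (M \<inter> N) < Suc (card M)"
    using card_mono[OF matching_finite[OF mM]] by (simp add: less_Suc_eq_le)
  moreover obtain N0 where "?Q N0" using miss_v by blast
  ultimately have "\<exists>N. ?Q N \<and> (\<forall>N'. ?Q N' \<longrightarrow> card (M \<inter> N') \<le> card (M \<inter> N))"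
    by (intro ex_has_greatest_nat)
  then obtain N where N: "?Q N" and best: "\<And>N'. ?Q N' \<Longrightarrow> card (M \<inter> N') \<le> card (M \<inter> N)"
    by (elim exE conjE) simp
  have mN: "matching E N" using N by (auto simp: maximum_matching_def)
  have uw: "u \<in> \<Union>N" "w \<in> \<Union>N" using sep_uv sep_vw N by blast+
  have "card M = card N" using M N mM mN by (meson le_antisym maximum_matching_def)
  then have same: "card (\<Union>M) = card (\<Union>N)" using card_Union_matching mM mN by metis
  note fin = card_Union_matching(1)[OF mM] card_Union_matching(1)[OF mN]
  \<comment> \<open>Both matchings cover equally many vertices. Only \<open>N\<close> covers the two
    vertices \<open>u\<close> and \<open>w\<close>, so \<open>M\<close> must cover at least two
    vertices missed by \<open>N\<close>, one of them besides \<open>v\<close>.\<close>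
  have "\<exists>x. x \<in> \<Union>M \<and> x \<notin> \<Union>N \<and> x \<noteq> v"
  proof (rule ccontr)
    assume "\<not> ?thesis"
    then have "\<Union>M - {v} \<subseteq> \<Union>N - {u, w}" using nc by auto
    then have "card (\<Union>M - {v}) \<le> card (\<Union>N - {u, w})" using fin by (intro card_mono) auto
    moreover have "card (\<Union>M - {v}) = card (\<Union>M) - 1" using vM fin by (simp add: card_Diff_singleton)
    moreover have "card (\<Union>N - {u, w}) = card (\<Union>N) - 2"
      using uw fin assms(5) by (subst card_Diff_subset) auto
    moreover have "card (\<Union>N) \<ge> 2" using card_mono[OF fin(2), of "{u, w}"] uw assms(5) by auto
    ultimately show False using same by linarith
  qed
  then obtain x where x: "x \<in> \<Union>M" "x \<notin> \<Union>N" "x \<noteq> v" by blast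
  then obtain N' where "?Q N'" "card (M \<inter> N) < card (M \<inter> N')"
    using maximum_matching_exchange[OF M, of N x v] N by metis
  then show False using best by (meson not_less)
qed

text \<open>Each part consists of the ends of the matching edges inside it and at most one missed
  vertex, so it contains at least \<open>card p div 2\<close> matching edges. Different parts
  contain different edges.\<close>

lemma card_matching_within_partition:
  assumes "matching E M" and P: "partition_on V P"
    and inside: "\<And>e. e \<in> E \<Longrightarrow> \<exists>p\<in>P. e \<subseteq> p"
    and one: "\<And>p x y. p \<in> P \<Longrightarrow> x \<in> p \<Longrightarrow> y \<in> p \<Longrightarrow> x \<notin> \<Union>M \<Longrightarrow> y \<notin> \<Union>M \<Longrightarrow> x = y"
  shows "(\<Sum>p\<in>P. card p div 2) \<le> card M"
proof -
  have ME: "M \<subseteq> E" using assms(1) by (simp add: matching_def)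
  note finM = matching_finite[OF assms(1)]
  have finP: "finite P" by (rule finite_elements[OF finite_V P])
  have finp: "finite p" if "p \<in> P" for p 
    using finite_V partition_onD1[OF P] that by (auto intro: finite_subset[of p V])
  let ?M = "\<lambda>p. {e \<in> M. e \<subseteq> p}"
  have disj: "p = q" if "p \<in> P" "q \<in> P" "x \<in> p" "x \<in> q" for p q x
    using partition_onD2[OF P] that by (auto simp: disjoint_def)
  have "card p div 2 \<le> card (?M p)" if p: "p \<in> P" for p
  proof -
    have m: "matching E (?M p)" using assms(1) by (auto simp: matching_def pairwise_def)
    have "p \<subseteq> \<Union>(?M p) \<union> (p - \<Union>M)"
    proof
      fix x assume x: "x \<in> p"
      show "x \<in> \<Union>(?M p) \<union> (p - \<Union>M)"
      proof (cases "x \<in> \<Union>M")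
        case True
        then obtain e where e: "e \<in> M" "x \<in> e" by blast
        then obtain q where "q \<in> P" "e \<subseteq> q" using inside ME by blast
        then have "e \<subseteq> p" using disj[OF p \<open>q \<in> P\<close> x] e by blast
        then show ?thesis using e by blast
      qed (use x in auto)
    qed
    then have "card p \<le> card (\<Union>(?M p) \<union> (p - \<Union>M))"
      using card_Union_matching(1)[OF m] finp[OF p] by (intro card_mono) auto
    also have "\<dots> \<le> card (\<Union>(?M p)) + card (p - \<Union>M)" by (rule card_Un_le)
    also have "card (p - \<Union>M) \<le> 1"
      using one[OF p] finp[OF p] by (auto simp: card_le_Suc0_iff_eq)
    finally show ?thesis using card_Union_matching(2)[OF m] by linarith
  qed
  then have "(\<Sum>p\<in>P. card p div 2) \<le> (\<Sum>p\<in>P. card (?M p))" by (rule sum_mono)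
  also have "\<dots> = card (\<Union>p\<in>P. ?M p)"
  proof (rule card_UN_disjoint[symmetric])
    show "\<forall>p\<in>P. \<forall>q\<in>P. p \<noteq> q \<longrightarrow> ?M p \<inter> ?M q = {}"
    proof (intro ballI impI, rule ccontr)
      fix p q assume pq: "p \<in> P" "q \<in> P" "p \<noteq> q" "?M p \<inter> ?M q \<noteq> {}"
      then obtain e where e: "e \<in> M" "e \<subseteq> p" "e \<subseteq> q" by blast
      then have "card e = 2" using ME edge by blast
      then obtain x where "x \<in> e" by fastforce
      then show False using disj e pq by blast
    qed
  qed (use finP finM in auto)
  also have "\<dots> \<le> card M" using finM by (intro card_mono) auto
  finally show ?thesis .
qed

text \<open>Gallai's lemma: the classes of "no maximum matching misses both" are unions of components.\<close>

lemma gallai_partition: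
  assumes miss: "\<And>v. v \<in> V \<Longrightarrow> \<exists>M. maximum_matching E M \<and> v \<notin> \<Union>M"
  shows "\<exists>P. partition_on V P \<and> (\<forall>e\<in>E. \<exists>p\<in>P. e \<subseteq> p) \<and>
    (\<forall>M. maximum_matching E M \<longrightarrow> (\<Sum>p\<in>P. card p div 2) \<le> card M)"
proof -
  \<comment> \<open>Equality is added by hand for reflexivity: the covering condition fails for
    \<open>u = v\<close>, since every vertex is missed by some maximum matching.\<close>
  define R where "R = {(u, v). u \<in> V \<and> v \<in> V \<and>
    (u = v \<or> (\<forall>M. maximum_matching E M \<longrightarrow> u \<in> \<Union>M \<or> v \<in> \<Union>M))}"
  have eqR: "equiv V R"
  proof (rule equivI)
    show "R \<subseteq> V \<times> V" by (auto simp: R_def)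
    show "refl_on V R" by (auto simp: R_def refl_on_def)
    show "sym R" by (auto simp: R_def sym_def)
    show "trans R"
    proof (rule transI)
      fix u v w assume uv: "(u, v) \<in> R" and vw: "(v, w) \<in> R"
      show "(u, w) \<in> R"
      proof (cases "u = v \<or> v = w \<or> u = w")
        case True then show ?thesis using uv vw by (auto simp: R_def)
      next
        case False
        then have 1: "\<And>M. maximum_matching E M \<Longrightarrow> u \<in> \<Union>M \<or> v \<in> \<Union>M"
          and 2: "\<And>M. maximum_matching E M \<Longrightarrow> v \<in> \<Union>M \<or> w \<in> \<Union>M"
          and 3: "u \<in> V" "v \<in> V" "w \<in> V" using uv vw unfolding R_def by blast+
        show ?thesis using inseparable_trans[OF 1 2 miss[OF 3(2)]] False 3 unfolding R_def by blast
      qed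
    qed
  qed
  have P: "partition_on V (V // R)" using eqR by (rule partition_on_quotient)
  have inside: "\<exists>p\<in>V // R. e \<subseteq> p" if e: "e \<in> E" for e
  proof -
    obtain x y where xy: "e = {x, y}" using edge[OF e] by (auto simp: card_2_iff)
    then have V: "x \<in> V" "y \<in> V" using edge[OF e] by auto
    have "(x, y) \<in> R" using maximum_matching_covers_edge e xy V by (fastforce simp: R_def)
    then have "e \<subseteq> R `` {x}" using xy V by (auto simp: R_def)
    then show ?thesis using V by (auto intro: quotientI)
  qed
  have "(\<Sum>p\<in>V // R. card p div 2) \<le> card M" if M: "maximum_matching E M" for M
  proof (rule card_matching_within_partition[OF _ P inside])
    show "matching E M" using M by (simp add: maximum_matching_def)
    fix p x y assume "p \<in> V // R" "x \<in> p" "y \<in> p" "x \<notin> \<Union>M" "y \<notin> \<Union>M"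
    moreover from this have "(x, y) \<in> R" using quotient_eq_iff[OF eqR, of p p x y] by blast
    ultimately show "x = y" using M unfolding R_def by blast
  qed
  then show ?thesis using P inside by blast
qed

end

section \<open>The Tutte-Berge formula\<close>

text \<open>The nontrivial half of the Tutte--Berge formula. The parts are unions of components of
  \<open>G - S\<close>, not necessarily single components; this suffices for counting and spares connectivity.\<close>

theorem tutte_berge:
  assumes "pregraph V E"
  shows "\<exists>S P M. S \<subseteq> V \<and> partition_on (V - S) P \<and> (\<forall>e\<in>E. e \<inter> S \<noteq> {} \<or> (\<exists>p\<in>P. e \<subseteq> p)) \<and>
    matching E M \<and> card S + (\<Sum>p\<in>P. card p div 2) \<le> card M"
  using assms
proof (induction "card V" arbitrary: V E rule: less_induct)
  case less
  interpret pregraph V E by (rule less.prems)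
  obtain M where M: "maximum_matching E M" using maximum_matching_exists by blast
  then have mM: "matching E M" by (simp add: maximum_matching_def)
  show ?case
  \<comment> \<open>If every vertex can be missed, Gallai's lemma applies with \<open>S\<close>
    empty. Otherwise some \<open>v\<close> is covered by all maximum matchings; it is deleted and
    later added to the \<open>S\<close> of the smaller graph.\<close>
  proof (cases "\<forall>v\<in>V. \<exists>M. maximum_matching E M \<and> v \<notin> \<Union>M")
    case True
    then obtain P where P: "partition_on V P" "\<forall>e\<in>E. \<exists>p\<in>P. e \<subseteq> p"
      "(\<Sum>p\<in>P. card p div 2) \<le> card M"
      using gallai_partition M by blast
    then show ?thesis using mM by (intro exI[of _ "{}"] exI[of _ P] exI[of _ M]) auto
  next
    case False
    then obtain v where v: "v \<in> V" and cov: "\<And>M. maximum_matching E M \<Longrightarrow> v \<in> \<Union>M" by blast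
    let ?E = "{e \<in> E. v \<notin> e}"
    have "pregraph (V - {v}) ?E" using finite_V edge by unfold_locales auto
    moreover have "card (V - {v}) < card V" using v finite_V by (intro psubset_card_mono) auto
    ultimately have "\<exists>S P M. S \<subseteq> V - {v} \<and> partition_on (V - {v} - S) P \<and>
      (\<forall>e\<in>?E. e \<inter> S \<noteq> {} \<or> (\<exists>p\<in>P. e \<subseteq> p)) \<and> matching ?E M \<and>
      card S + (\<Sum>p\<in>P. card p div 2) \<le> card M"
      by (intro less.hyps)
    then obtain S P N where IH: "S \<subseteq> V - {v}" "partition_on (V - {v} - S) P"
      "\<forall>e\<in>?E. e \<inter> S \<noteq> {} \<or> (\<exists>p\<in>P. e \<subseteq> p)" "matching ?E N"
      "card S + (\<Sum>p\<in>P. card p div 2) \<le> card N"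
      by (elim exE conjE)
    have N: "matching E N" "v \<notin> \<Union>N" using IH(4) by (auto simp: matching_def)
    \<comment> \<open>A matching that misses \<open>v\<close> is not maximum. The unit gained in
      passing from \<open>N\<close> to \<open>M\<close> pays for adding \<open>v\<close> to
      \<open>S\<close>.\<close>
    have "card N < card M"
      using N cov M unfolding maximum_matching_def by (metis le_less_linear le_trans)
    moreover have "card (insert v S) = Suc (card S)"
      using IH(1) finite_V by (intro card_insert_disjoint) (auto intro: finite_subset)
    ultimately have "card (insert v S) + (\<Sum>p\<in>P. card p div 2) \<le> card M"
      using IH(5) by linarith
    moreover have "V - insert v S = V - {v} - S" by auto
    then have "partition_on (V - insert v S) P" using IH(2) by simp
    moreover have "\<forall>e\<in>E. e \<inter> insert v S \<noteq> {} \<or> (\<exists>p\<in>P. e \<subseteq> p)" using IH(3) by blast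
    moreover have "insert v S \<subseteq> V" using IH(1) v by blast
    ultimately show ?thesis using mM
      by (intro exI[of _ "insert v S"] exI[of _ P] exI[of _ M] conjI)
  qed
qed

section \<open>Connectivity and crossing edges\<close>

lemma connected_cut:
  assumes "graph_connected V E" "A \<subseteq> V" "A \<noteq> {}" "A \<noteq> V"
  shows "\<exists>a b. a \<in> A \<and> b \<notin> A \<and> {a, b} \<in> E"
proof -
  obtain u v where u: "u \<in> A" and v: "v \<in> V" "v \<notin> A" using assms by blast
  have "(u, v) \<in> (adj E)\<^sup>*" using assms u v by (auto simp: graph_connected_def)
  \<comment> \<open>Invariant along the walk: as long as no edge leaving \<open>A\<close> has been
    met, the current vertex is still in \<open>A\<close>.\<close>
  then have "v \<notin> A \<longrightarrow> ?thesis"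
    using u by (induction rule: rtrancl_induct) (auto simp: adj_def)
  then show ?thesis using v by blast
qed

text \<open>Contracting the classes of \<open>Q\<close> leaves a connected graph, whose spanning
  tree has \<open>card Q - 1\<close> edges, all from \<open>F\<close>. Instead of forming the
  quotient, the proof grows a family of classes as in Prim's algorithm, each new class bringing a
  new edge of \<open>F\<close>.\<close>

lemma connected_partition_crossing:
  assumes "graph_connected V E" "finite V" "finite E" "\<Union>E \<subseteq> V" and Q: "partition_on V Q"
    and "F \<subseteq> E" and "\<And>e. e \<in> E \<Longrightarrow> e \<notin> F \<Longrightarrow> \<exists>q\<in>Q. e \<subseteq> q"
  shows "card Q \<le> card F + 1"
proof -
  have finQ: "finite Q" by (rule finite_elements[OF assms(2) Q])
  have finF: "finite F" using assms finite_subset by blast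
  have disj: "p = q" if "p \<in> Q" "q \<in> Q" "x \<in> p" "x \<in> q" for p q x
    using partition_onD2[OF Q] that by (auto simp: disjoint_def)
  have "\<exists>R\<subseteq>Q. card R = Suc i \<and> i \<le> card {e \<in> F. e \<subseteq> \<Union>R}" if "Suc i \<le> card Q" for i
    using that
  proof (induction i)
    case 0
    then obtain q where "q \<in> Q" by fastforce
    then show ?case by (intro exI[of _ "{q}"]) auto
  next
    case (Suc i)
    then obtain R where R: "R \<subseteq> Q" "card R = Suc i" "i \<le> card {e \<in> F. e \<subseteq> \<Union>R}" by auto
    have "R \<noteq> Q" using R(2) Suc.prems by auto
    then obtain q0 where q0: "q0 \<in> Q" "q0 \<notin> R" using R(1) by blast
    obtain x0 where x0: "x0 \<in> q0" using q0 partition_onD3[OF Q] by (metis ex_in_conv)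
    have "\<Union>R \<subseteq> V" using R(1) partition_onD1[OF Q] by blast
    moreover have "x0 \<in> V" "x0 \<notin> \<Union>R" using x0 q0 R(1) disj partition_onD1[OF Q] by blast+
    moreover have "R \<noteq> {}" using R(2) by auto
    then have "\<Union>R \<noteq> {}" using R(1) partition_onD3[OF Q] by (metis Union_empty_conv all_not_in_conv subsetD)
    ultimately obtain a b where ab: "a \<in> \<Union>R" "b \<notin> \<Union>R" "{a, b} \<in> E"
      using connected_cut[OF assms(1), of "\<Union>R"] by blast
    have "b \<in> V" using ab assms(4) by blast
    then obtain q where q: "q \<in> Q" "b \<in> q" using partition_onD1[OF Q] by blast
    have qR: "q \<notin> R" using q ab by blast
    \<comment> \<open>An edge outside \<open>F\<close> would lie in one class, namely the class in
      \<open>R\<close> containing \<open>a\<close>, and this would put \<open>b\<close> into the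
      union of \<open>R\<close>.\<close>
    have "{a, b} \<in> F"
    proof (rule ccontr)
      assume "{a, b} \<notin> F"
      then obtain p where p: "p \<in> Q" "{a, b} \<subseteq> p" using assms(7) ab(3) by blast
      obtain r where r: "r \<in> R" "a \<in> r" using ab(1) by blast
      then have "p = r" using disj[of p r a] p R(1) by blast
      then show False using r p ab(2) by blast
    qed
    then have "insert {a, b} {e \<in> F. e \<subseteq> \<Union>R} \<subseteq> {e \<in> F. e \<subseteq> \<Union>(insert q R)}"
      using ab q by auto
    then have "card (insert {a, b} {e \<in> F. e \<subseteq> \<Union>R}) \<le> card {e \<in> F. e \<subseteq> \<Union>(insert q R)}"
      using finF by (intro card_mono) auto
    moreover have "card (insert {a, b} {e \<in> F. e \<subseteq> \<Union>R}) = Suc (card {e \<in> F. e \<subseteq> \<Union>R})"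
      using ab finF by (intro card_insert_disjoint) auto
    moreover have "card (insert q R) = Suc (Suc i)"
      using qR R finQ by (metis card_insert_disjoint finite_subset)
    ultimately show ?case using R q by (intro exI[of _ "insert q R"]) auto
  qed
  note grow = this
  show ?thesis
  proof (cases "card Q")
    case (Suc i)
    then obtain R where "i \<le> card {e \<in> F. e \<subseteq> \<Union>R}" using grow[of i] by auto
    also have "\<dots> \<le> card F" using finF by (intro card_mono) auto
    finally show ?thesis using Suc by simp
  qed simp
qed

section \<open>Counting edges by degrees\<close>

lemma sum_degree_eq:
  assumes "finite E" "finite A"
  shows "(\<Sum>v\<in>A. degree E v) = (\<Sum>e\<in>E. card (e \<inter> A))"
proof -
  have "(\<Sum>v\<in>A. degree E v) = (\<Sum>v\<in>A. \<Sum>e\<in>E. if v \<in> e then 1 else 0)"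
    using assms by (simp add: degree_def sum.If_cases Int_def)
  also have "\<dots> = (\<Sum>e\<in>E. \<Sum>v\<in>A. if v \<in> e then 1 else 0)" by (rule sum.swap)
  also have "\<dots> = (\<Sum>e\<in>E. card (e \<inter> A))"
    using assms by (intro sum.cong) (simp_all add: sum.If_cases Int_def conj_commute)
  finally show ?thesis .
qed

context simple_graph
begin

lemma edges_meeting_le:
  assumes "S \<subseteq> V" "max_degree V E \<le> k"
  shows "card {e \<in> E. e \<inter> S \<noteq> {}} \<le> k * card S"
proof -
  have S: "finite S" using assms finite_verts finite_subset by blast
  have "card {e \<in> E. e \<inter> S \<noteq> {}} = (\<Sum>e\<in>{e \<in> E. e \<inter> S \<noteq> {}}. 1)" by simp
  also have "\<dots> \<le> (\<Sum>e\<in>{e \<in> E. e \<inter> S \<noteq> {}}. card (e \<inter> S))"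
    using S by (intro sum_mono) (simp add: Suc_le_eq card_gt_0_iff)
  also have "\<dots> \<le> (\<Sum>e\<in>E. card (e \<inter> S))" using finite_edges by (intro sum_mono2) auto
  also have "\<dots> = (\<Sum>v\<in>S. degree E v)" using sum_degree_eq[OF finite_edges S] by simp
  also have "\<dots> \<le> (\<Sum>v\<in>S. k)"
    using degree_le_max_degree assms by (intro sum_mono) (meson le_trans subsetD)
  finally show ?thesis by (simp add: mult.commute)
qed

text \<open>An edge inside \<open>p\<close> uses two units of the degree sum over \<open>p\<close>,
  an edge leaving \<open>p\<close> one. The second summand lets a single leaving edge sharpen the
  bound on the inner edges.\<close>

lemma edges_inside_le_degree:
  assumes "p \<subseteq> V" "max_degree V E \<le> k"
  shows "2 * card {e \<in> E. e \<subseteq> p} + card {e \<in> E. e \<inter> p \<noteq> {} \<and> \<not> e \<subseteq> p} \<le> k * card p"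
proof -
  have p: "finite p" using assms finite_verts finite_subset by blast
  let ?A = "{e \<in> E. e \<subseteq> p}" and ?B = "{e \<in> E. e \<inter> p \<noteq> {} \<and> \<not> e \<subseteq> p}"
  have "2 * card ?A = (\<Sum>e\<in>?A. card (e \<inter> p))"
    using edges by (simp add: Int_absorb2)
  moreover have "card ?B \<le> (\<Sum>e\<in>?B. card (e \<inter> p))"
  proof -
    have "card ?B = (\<Sum>e\<in>?B. 1)" by simp
    also have "\<dots> \<le> (\<Sum>e\<in>?B. card (e \<inter> p))"
      using p by (intro sum_mono) (simp add: Suc_le_eq card_gt_0_iff)
    finally show ?thesis .
  qed
  moreover have "(\<Sum>e\<in>?A. card (e \<inter> p)) + (\<Sum>e\<in>?B. card (e \<inter> p)) = (\<Sum>e\<in>?A \<union> ?B. card (e \<inter> p))"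
    using finite_edges by (intro sum.union_disjoint[symmetric]) auto
  moreover have "\<dots> \<le> (\<Sum>e\<in>E. card (e \<inter> p))" using finite_edges by (intro sum_mono2) auto
  moreover have "(\<Sum>e\<in>E. card (e \<inter> p)) = (\<Sum>v\<in>p. degree E v)"
    using sum_degree_eq[OF finite_edges p] by simp
  moreover have "(\<Sum>v\<in>p. degree E v) \<le> (\<Sum>v\<in>p. k)"
    using degree_le_max_degree assms by (intro sum_mono) (meson le_trans subsetD)
  ultimately show ?thesis by (simp add: mult.commute)
qed

lemma edges_inside_le_choose:
  assumes "p \<subseteq> V"
  shows "2 * card {e \<in> E. e \<subseteq> p} \<le> card p * (card p - 1)"
proof -
  have p: "finite p" using assms finite_verts finite_subset by blast
  have "card {e \<in> E. e \<subseteq> p} \<le> card {e. e \<subseteq> p \<and> card e = 2}"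
    using edges p by (intro card_mono) (auto intro: finite_subset[of _ "Pow p"])
  also have "\<dots> = card p choose 2" using p by (rule n_subsets)
  finally show ?thesis by (simp add: choose_two)
qed

lemma card_edges_partition:
  assumes "partition_on (V - S) P" "\<And>e. e \<in> E \<Longrightarrow> e \<inter> S \<noteq> {} \<or> (\<exists>p\<in>P. e \<subseteq> p)"
  shows "card E = card {e \<in> E. e \<inter> S \<noteq> {}} + (\<Sum>p\<in>P. card {e \<in> E. e \<subseteq> p})"
proof -
  let ?F = "{e \<in> E. e \<inter> S \<noteq> {}}" and ?I = "\<lambda>p. {e \<in> E. e \<subseteq> p}"
  have finP: "finite P" using finite_elements[OF _ assms(1)] finite_verts by blast
  have ne: "e \<noteq> {}" if "e \<in> E" for e using edges[OF that] by auto
  have pS: "p \<inter> S = {}" if "p \<in> P" for p using partition_onD1[OF assms(1)] that by blast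
  have disj: "p = q" if "p \<in> P" "q \<in> P" "e \<in> E" "e \<subseteq> p" "e \<subseteq> q" for p q e
  proof -
    obtain x where "x \<in> e" using ne[OF \<open>e \<in> E\<close>] by blast
    then have "x \<in> p \<inter> q" using that by blast
    then show ?thesis using partition_onD2[OF assms(1)] that unfolding disjoint_def by blast
  qed
  have "E = ?F \<union> (\<Union>p\<in>P. ?I p)" using assms(2) by auto
  then have "card E = card (?F \<union> (\<Union>p\<in>P. ?I p))" by simp
  also have "\<dots> = card ?F + card (\<Union>p\<in>P. ?I p)"
    using finite_edges finP pS ne by (intro card_Un_disjoint) (simp, simp, blast)
  also have "card (\<Union>p\<in>P. ?I p) = (\<Sum>p\<in>P. card (?I p))"
    using finite_edges finP disj by (intro card_UN_disjoint) auto
  finally show ?thesis .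
qed

end

section \<open>The inequality for a single part\<close>

text \<open>One part contributes its order \<open>n\<close>, its number \<open>e\<close> of inner edges, and \<open>n div 2\<close>
  to the Tutte--Berge bound. The worst case \<open>K\<^bsub>k+1\<^esub>\<close> is excluded as soon as an edge leaves the part;
  evenness of \<open>k\<close> then makes \<open>k * n - 2 * e\<close> at least 2.\<close>

lemma part_bounds:
  fixes k n e :: nat
  assumes k: "k \<ge> 4" "even k" and choose: "2 * e \<le> n * (n - 1)" and deg: "2 * e + c \<le> k * n"
    and c: "c \<le> 1"
  shows "int (k * (k + 1)) * int (n div 2) - int n - int k * int e \<ge> - int (k + 1) + int k * int c"
    and "int (k\<^sup>2 + k + 2) * int (n div 2) + (int k - 2) * int n - int (k + 2) * int e
           \<ge> - int (k + 2) + int (k + 2) * int c"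
proof -
  obtain i where i: "k = 2 * i" using k by blast
  define j where "j = int i"
  define h where "h = int (n div 2)"
  have j: "int k = 2 * j" "j \<ge> 2" using i k by (auto simp: j_def)
  have h: "h \<ge> 0" by (simp add: h_def)
  \<comment> \<open>Names for the products, so that after substituting \<open>k = 2 * j\<close> both
    claims are linear apart from \<open>j * Z\<close>, which serves as one more atom.\<close>
  define X T D Z where "X = j * int e" and "T = j * int n" and "D = j * int c" and "Z = j * h"
  have "(4 * (j * Z) + 2 * Z - int n - 2 * X \<ge> - (2 * j + 1) + 2 * D) \<and>
    (4 * (j * Z) + 2 * Z + 2 * h + 2 * T - 2 * int n - 2 * X - 2 * int e
       \<ge> - (2 * j + 2) + 2 * D + 2 * int c)"
  proof -
    have D: "D = 0 \<and> c = 0 \<or> D = j \<and> c = 1" using c by (auto simp: D_def)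
    have hZ: "h \<le> Z" using mult_right_mono[of 1 j h] j h by (simp add: Z_def)
    \<comment> \<open>Odd orders split at \<open>k\<close>: from \<open>k + 1\<close> on the degree
      bound is at least as strong as the bound by the number of pairs, and up to
      \<open>k - 1\<close> the latter is stronger.\<close>
    consider (even) "int n = 2 * h" | (big) "int n = 2 * h + 1" "h \<ge> j"
      | (small) "int n = 2 * h + 1" "h \<le> j - 1"
    proof -
      have "int n = 2 * h \<or> int n = 2 * h + 1" unfolding h_def by presburger
      then show ?thesis using that by linarith
    qed
    then show ?thesis
    proof cases
      case even
      have "2 * int e \<le> int k * int n" using deg by (metis add_leD1 of_nat_le_iff of_nat_mult of_nat_numeral)
      then have e: "int e \<le> 2 * Z" using even j by (simp add: Z_def algebra_simps)
      have "X \<le> 2 * (j * Z)" using mult_left_mono[OF e, of j] j by (simp only: X_def algebra_simps)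
      moreover have "T = 2 * Z" by (simp add: T_def Z_def even)
      ultimately show ?thesis using e even D hZ j by linarith
    next
      case big
      have "2 * (i * n) \<ge> 2 * e + c" using deg i by simp
      \<comment> \<open>Parity: both \<open>2 * e\<close> and \<open>2 * (i * n)\<close> are even,
        so one leaving edge costs a whole inner edge.\<close>
      then have "e + c \<le> i * n" using c by linarith
      then have "int e + int c \<le> j * int n"
        unfolding j_def by (metis of_nat_add of_nat_mult of_nat_mono)
      then have e: "int e \<le> 2 * Z + j - int c" using big(1) by (simp add: Z_def algebra_simps)
      have "X \<le> 2 * (j * Z) + j * j - D"
        using mult_left_mono[OF e, of j] j by (simp only: X_def D_def algebra_simps)
      \<comment> \<open>This product is half the slack in the first inequality when \<open>e\<close>
        is as large as the degree bound allows; it vanishes at order \<open>k + 1\<close>.\<close>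
      moreover have "0 \<le> (j - 1) * (h - j)" using j big by simp
      then have "0 \<le> Z - j * j - h + j" by (simp add: Z_def algebra_simps)
      moreover have "T = 2 * Z + j" by (simp add: T_def Z_def big algebra_simps)
      ultimately show ?thesis using e big by linarith
    next
      case small
      have "2 * int e \<le> int n * (int n - 1)"
      proof -
        have "int (2 * e) \<le> int (n * (n - 1))" using choose by (rule of_nat_mono)
        moreover have "n \<ge> 1" using small h by linarith
        ultimately show ?thesis by (simp add: of_nat_diff)
      qed
      then have e: "int e \<le> 2 * (h * h) + h" using small by (simp add: algebra_simps)
      have "X \<le> 2 * (j * (h * h)) + Z"
        using mult_left_mono[OF e, of j] j by (simp only: X_def Z_def algebra_simps)
      \<comment> \<open>These two products absorb the terms \<open>h * h\<close> and
        \<open>j * (h * h)\<close> coming from the pair bound.\<close>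
      moreover have "0 \<le> h * (j - 1 - h)" "0 \<le> Z * (j - 1 - h)" using small h hZ by simp_all
      then have "0 \<le> Z - h - h * h" "0 \<le> j * Z - Z - j * (h * h)"
        by (simp_all only: Z_def algebra_simps)
      moreover have "T = 2 * Z + j" by (simp add: T_def Z_def small algebra_simps)
      ultimately show ?thesis using e small D hZ h j by linarith
    qed
  qed
  then show "int (k * (k + 1)) * int (n div 2) - int n - int k * int e \<ge> - int (k + 1) + int k * int c"
    and "int (k\<^sup>2 + k + 2) * int (n div 2) + (int k - 2) * int n - int (k + 2) * int e
           \<ge> - int (k + 2) + int (k + 2) * int c"
    using j(1) by (simp_all add: h_def X_def T_def D_def Z_def algebra_simps power2_eq_square)
qed

section \<open>Summing over the parts\<close>

text \<open>The two bounds with denominators cleared. If \<open>S\<close> is empty there is at most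
  one part, and its deficit is the additive constant. Otherwise every part has a leaving edge, and
  its deficit drops to 1 in the first bound and to 0 in the second.\<close>

lemma matching_number_integer_bounds:
  fixes V :: "'a set" and E :: "'a set set" and k :: nat
  assumes k: "k \<ge> 4" "even k" and G: "simple_graph V E" and con: "graph_connected V E"
    and max: "max_degree V E \<le> k"
  shows "int (k * (k + 1)) * int (matching_number E)
      \<ge> int (card V) + int k * int (card E) - int (k + 1)"
    and "int (k\<^sup>2 + k + 2) * int (matching_number E)
      \<ge> int (k + 2) * int (card E) - (int k - 2) * int (card V) - int (k + 2)"
proof -
  interpret simple_graph V E by (rule G)
  have "pregraph V E" using finite_verts edges by unfold_locales auto
  then obtain S P M where S: "S \<subseteq> V" and P: "partition_on (V - S) P"
    and cover: "\<And>e. e \<in> E \<Longrightarrow> e \<inter> S \<noteq> {} \<or> (\<exists>p\<in>P. e \<subseteq> p)"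
    and M: "matching E M" "card S + (\<Sum>p\<in>P. card p div 2) \<le> card M"
    using tutte_berge by metis
  define F where "F = {e \<in> E. e \<inter> S \<noteq> {}}"
  define inner where "inner p = card {e \<in> E. e \<subseteq> p}" for p
  define c where "c = (if S = {} then 0 else 1 :: nat)"
  have finS: "finite S" using S finite_verts finite_subset by blast
  have finP: "finite P" using finite_elements[OF _ P] finite_verts by blast
  have nu: "card S + (\<Sum>p\<in>P. card p div 2) \<le> matching_number E"
    using M card_matching_le le_trans by blast
  have pV: "p \<subseteq> V" "p \<inter> S = {}" if "p \<in> P" for p using partition_onD1[OF P] that by blast+
  have n: "card V = card S + (\<Sum>p\<in>P. card p)"
  proof -
    have "card (V - S) = (\<Sum>p\<in>P. card p)" 
      unfolding partition_onD1[OF P] using partition_onD2[OF P] finite_subset[OF pV(1) finite_verts]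
      by (intro card_Union_disjoint) (auto simp: disjoint_def pairwise_def disjnt_def)
    moreover have "card V = card S + card (V - S)"
      using S finS finite_verts by (metis card_Diff_subset card_mono le_add_diff_inverse)
    ultimately show ?thesis by simp
  qed
  have m: "card E = card F + (\<Sum>p\<in>P. inner p)"
    unfolding F_def inner_def using card_edges_partition[OF P cover] .
  have F: "card F \<le> k * card S" unfolding F_def by (rule edges_meeting_le[OF S max])
  have tree: "card P + card S \<le> card F + 1"
  proof -
    \<comment> \<open>The classes are the parts together with the single vertices of
      \<open>S\<close>; only edges meeting \<open>S\<close> can join different classes.\<close>
    let ?Q = "P \<union> (\<lambda>v. {v}) ` S"
    have Q: "partition_on V ?Q"
      using P S unfolding partition_on_def disjoint_def by (auto; blast)
    have "card ?Q \<le> card F + 1"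
    proof (rule connected_partition_crossing[OF con finite_verts finite_edges _ Q])
      show "\<Union>E \<subseteq> V" using edges by blast
      show "F \<subseteq> E" by (simp add: F_def)
      show "\<exists>q\<in>?Q. e \<subseteq> q" if "e \<in> E" "e \<notin> F" for e
        using cover[OF that(1)] that unfolding F_def by blast
    qed
    moreover have "card ?Q = card P + card ((\<lambda>v. {v}) ` S)"
      using finP finS pV by (intro card_Un_disjoint) auto
    moreover have "card ((\<lambda>v. {v}) ` S) = card S" by (intro card_image) auto
    ultimately show ?thesis by simp
  qed
  have part: "2 * inner p + c \<le> k * card p" "2 * inner p \<le> card p * (card p - 1)" if p: "p \<in> P" for p
  proof -
    let ?B = "{e \<in> E. e \<inter> p \<noteq> {} \<and> \<not> e \<subseteq> p}"
    have "c \<le> card ?B"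
    proof (cases "S = {}")
      case False
      \<comment> \<open>A part is nonempty and avoids the nonempty \<open>S\<close>, so
        connectedness supplies an edge leaving it.\<close>
      have "p \<noteq> {}" "p \<noteq> V" using False S pV[OF p] partition_onD3[OF P] p by auto
      then obtain a b where "a \<in> p" "b \<notin> p" "{a, b} \<in> E" using connected_cut[OF con pV(1)[OF p]] by blast
      then have "{a, b} \<in> ?B" by auto
      then have "card ?B > 0" using finite_edges by (subst card_gt_0_iff) auto
      then show ?thesis by (simp add: c_def)
    qed (simp add: c_def)
    then show "2 * inner p + c \<le> k * card p"
      using edges_inside_le_degree[OF pV(1)[OF p] max] by (simp add: inner_def)
    show "2 * inner p \<le> card p * (card p - 1)"
      using edges_inside_le_choose[OF pV(1)[OF p]] by (simp add: inner_def)
  qed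
  have c1: "c \<le> 1" by (simp add: c_def)
  note bounds = part_bounds[OF k part(2) part(1) c1]
  define H where "H = (\<Sum>p\<in>P. int (card p div 2))"
  define N where "N = (\<Sum>p\<in>P. int (card p))"
  define I where "I = (\<Sum>p\<in>P. int (inner p))"
  have nu': "int (card S) + H \<le> int (matching_number E)"
    using nu unfolding H_def of_nat_sum[symmetric] by linarith
  have n': "int (card V) = int (card S) + N" using n by (simp add: N_def)
  have m': "int (card E) = int (card F) + I" using m by (simp add: I_def)
  have F': "int (card F) \<le> int k * int (card S)" using F by (metis of_nat_mono of_nat_mult)
  have "(\<Sum>p\<in>P. - int (k + 1) + int k * int c)
      \<le> (\<Sum>p\<in>P. int (k * (k + 1)) * int (card p div 2) - int (card p) - int k * int (inner p))"
    by (intro sum_mono bounds(1))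
  then have A: "int (card P) * (- int (k + 1) + int k * int c)
      \<le> int (k * (k + 1)) * H - N - int k * I"
    by (simp only: sum_subtractf sum_distrib_left[symmetric] H_def N_def I_def sum_constant)
  have "(\<Sum>p\<in>P. - int (k + 2) + int (k + 2) * int c)
      \<le> (\<Sum>p\<in>P. int (k\<^sup>2 + k + 2) * int (card p div 2) + (int k - 2) * int (card p) - int (k + 2) * int (inner p))"
    by (intro sum_mono bounds(2))
  then have B: "int (card P) * (- int (k + 2) + int (k + 2) * int c)
      \<le> int (k\<^sup>2 + k + 2) * H + (int k - 2) * N - int (k + 2) * I"
    unfolding sum_constant
    by (simp only: sum_subtractf sum.distrib sum_distrib_left[symmetric] H_def N_def I_def)
  have A': "int (k * (k + 1)) * (int (card S) + H) \<le> int (k * (k + 1)) * int (matching_number E)"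
    and B': "int (k\<^sup>2 + k + 2) * (int (card S) + H) \<le> int (k\<^sup>2 + k + 2) * int (matching_number E)"
    using nu' by (intro mult_left_mono; simp)+
  have F1: "int (k + 1) * int (card F) \<le> int (k + 1) * (int k * int (card S))"
    and F2: "int (k + 2) * int (card F) \<le> int (k + 2) * (int k * int (card S))"
    using F' by (intro mult_left_mono; simp)+
  have P0: "S = {} \<Longrightarrow> card P \<le> 1" using tree by (simp add: F_def)
  \<comment> \<open>\<open>F1\<close> provides \<open>(k + 1) * card F\<close> where the first bound
    needs only \<open>k * card F\<close>. By \<open>tree\<close>, the spare \<open>card F\<close>
    pays for one unit per part and one per vertex of \<open>S\<close>, up to the constant.\<close>
  have Pa: "int (card P) * (- int (k + 1) + int k * int c)
      \<ge> - (int (card F) + 1 - int (card S)) - int k"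
  proof (cases "S = {}")
    case True
    then have "card P = 0 \<or> card P = 1" using P0 by linarith
    then show ?thesis using True by (auto simp: c_def F_def)
  next
    case False
    then show ?thesis using tree by (simp add: c_def)
  qed
  have Pb: "int (card P) * (- int (k + 2) + int (k + 2) * int c) \<ge> - int (k + 2)"
  proof (cases "S = {}")
    case True
    then have "card P = 0 \<or> card P = 1" using P0 by linarith
    then show ?thesis using True by (auto simp: c_def)
  qed (simp add: c_def)
  show "int (k * (k + 1)) * int (matching_number E)
      \<ge> int (card V) + int k * int (card E) - int (k + 1)"
    using A A' F1 Pa unfolding n' m' by (simp add: algebra_simps)
  \<comment> \<open>For the vertices of \<open>S\<close> the coefficients add up as
    \<open>(k^2 + k + 2) + (k - 2) = k * (k + 2)\<close>, which is exactly what \<open>F2\<close>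
    consumes.\<close>
  show "int (k\<^sup>2 + k + 2) * int (matching_number E)
      \<ge> int (k + 2) * int (card E) - (int k - 2) * int (card V) - int (k + 2)"
    using B B' F2 Pb unfolding n' m' by (simp add: algebra_simps power2_eq_square)
qed

theorem theoremC:
  fixes V :: "'a set" and E :: "'a set set" and k n m :: nat
  assumes "k \<ge> 4" and "even k"
    and "simple_graph V E" and "graph_connected V E"
    and "card V = n" and "card E = m"
    and "max_degree V E \<le> k"
  shows "real (matching_number E) \<ge>
           real n / (real k * (real k + 1)) + real m / (real k + 1) - 1 / real k
       \<and> real (matching_number E) \<ge>
           ((real k + 2) / ((real k)\<^sup>2 + real k + 2)) * real m
           - ((real k - 2) / ((real k)\<^sup>2 + real k + 2)) * real n
           - (real k + 2) / ((real k)\<^sup>2 + real k + 2)"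
proof
  note ib = matching_number_integer_bounds[OF assms(1-4,7), unfolded assms(5,6)]
  have k0: "real k > 0" using assms(1) by simp
  let ?a = "real k * (real k + 1)" and ?b = "(real k)\<^sup>2 + real k + 2"
  have a: "?a > 0" and b: "?b > 0" using k0 by (simp_all add: add_pos_pos)
  have "real_of_int (int n + int k * int m - int (k + 1))
      \<le> real_of_int (int (k * (k + 1)) * int (matching_number E))"
    using ib(1) by (rule of_int_le_iff[THEN iffD2])
  then have "real n + real k * real m - (real k + 1) \<le> ?a * real (matching_number E)"
    by (simp add: algebra_simps)
  then have "(real n + real k * real m - (real k + 1)) / ?a \<le> real (matching_number E)"
    using a by (simp add: pos_divide_le_eq mult.commute)
  moreover have "(real n + real k * real m - (real k + 1)) / ?a
      = real n / ?a + real m / (real k + 1) - 1 / real k"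
    using k0 by (simp add: divide_simps)
  ultimately show "real (matching_number E) \<ge> real n / ?a + real m / (real k + 1) - 1 / real k" by simp
  have "real_of_int (int (k + 2) * int m - (int k - 2) * int n - int (k + 2))
      \<le> real_of_int (int (k\<^sup>2 + k + 2) * int (matching_number E))"
    using ib(2) by (rule of_int_le_iff[THEN iffD2])
  then have "(real k + 2) * real m - (real k - 2) * real n - (real k + 2)
      \<le> ?b * real (matching_number E)" by (simp add: algebra_simps)
  then have "((real k + 2) * real m - (real k - 2) * real n - (real k + 2)) / ?b
      \<le> real (matching_number E)"
    using b by (simp add: pos_divide_le_eq mult.commute)
  then show "real (matching_number E) \<ge> ((real k + 2) / ?b) * real m
      - ((real k - 2) / ?b) * real n - (real k + 2) / ?b"
    by (simp add: diff_divide_distrib left_diff_distrib)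
qed

end
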